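(* Let $p\ge1$ and $n\ge2p$ be integers. Then for all $\beta>0$ and all $U,\widetilde U\in\mathrm{St}(n,p)$, $$\min\{1,\sqrt\beta\}\,\|\widetilde U-U\|_{\mathrm F}\le d_\beta(\widetilde U,U)\le\max\{1,\sqrt\beta\}\,\frac{\pi}{2}\|\widetilde U-U\|_{\mathrm F}.$$
   Context: The Stiefel manifold is $\mathrm{St}(n,p)=\{U\in\mathbb{R}^{n\times p} : U^TU=I_p\}$, with tangent space $T_U\mathrm{St}(n,p)=\{\Delta\in\mathbb{R}^{n\times p} : U^T\Delta+\Delta^TU=0\}$; $\|\cdot\|_{\mathrm F}$ is the Frobenius norm. For $\beta>0$ the $\beta$-metric is $\langle\Delta,\widetilde\Delta\rangle_\beta=\mathrm{Tr}\big(\Delta^T(I_n-(1-\beta)UU^T)\widetilde\Delta\big)$ for $\Delta,\widetilde\Delta\in T_U\mathrm{St}(n,p)$, with norm $\|\Delta\|_\beta=\sqrt{\langle\Delta,\Delta\rangle_\beta}$. The length of a continuously differentiable curve $\gamma:[0,1]\to\mathrm{St}(n,p)$ is $l_\beta(\gamma)=\int_0^1\|\dot\gamma(t)\|_\beta\,dt$, and the geodesic $\beta$-distance is $d_\beta(U,\widetilde U)=\inf\{l_\beta(\gamma) : \gamma(0)=U,\ \gamma(1)=\widetilde U\}$, the infimum being over continuously differentiable curves in $\mathrm{St}(n,p)$. *)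

theory Defs
  imports "HOL-Analysis.Analysis"
begin

text \<open>
  An \<open>n\<close> by \<open>p\<close> real matrix is an element of \<open>real ^ 'p ^ 'n\<close>, with
  \<open>n = CARD('n)\<close> and \<open>p = CARD('p)\<close>. The Frobenius norm is the library norm of this type:
\<close>

lemma norm_eq_frobenius:
  fixes A :: "real ^ 'p ^ 'n"
  shows "norm A = sqrt (trace (transpose A ** A))"
proof -
  have "trace (transpose A ** A) = (\<Sum>j\<in>UNIV. \<Sum>i\<in>UNIV. A $ i $ j * A $ i $ j)"
    by (simp add: trace_def matrix_matrix_mult_def transpose_def)
  also have "\<dots> = (\<Sum>i\<in>UNIV. \<Sum>j\<in>UNIV. A $ i $ j * A $ i $ j)"
    by (rule sum.swap)
  also have "\<dots> = inner A A"
    by (simp add: inner_vec_def)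
  finally show ?thesis
    by (simp add: norm_eq_sqrt_inner)
qed

definition stiefel :: "(real ^ 'p ^ 'n) set" where
  "stiefel = {U. transpose U ** U = mat 1}"

definition stiefel_tangent :: "real ^ 'p ^ 'n \<Rightarrow> (real ^ 'p ^ 'n) set" where
  "stiefel_tangent U = {D. transpose U ** D + transpose D ** U = 0}"

text \<open>
  The \<open>\<beta>\<close>-metric at the base point \<open>U\<close>. The formula makes sense for arbitrary matrices; it is
  only ever applied at \<open>U \<in> stiefel\<close> to elements of \<open>stiefel_tangent U\<close>
  (see \<open>stiefel_curve_velocity_tangent\<close> below).
\<close>

definition beta_inner ::
  "real \<Rightarrow> real ^ 'p ^ 'n \<Rightarrow> real ^ 'p ^ 'n \<Rightarrow> real ^ 'p ^ 'n \<Rightarrow> real" where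
  "beta_inner \<beta> U D E = trace (transpose D ** (mat 1 - (1 - \<beta>) *\<^sub>R (U ** transpose U)) ** E)"

definition beta_norm :: "real \<Rightarrow> real ^ 'p ^ 'n \<Rightarrow> real ^ 'p ^ 'n \<Rightarrow> real" where
  "beta_norm \<beta> U D = sqrt (beta_inner \<beta> U D D)"

text \<open>
  Derivatives are taken within \<open>{0..1}\<close>, so they are one-sided at the end points and the
  values of \<open>\<gamma>\<close> outside \<open>{0..1}\<close> play no role. (The library's \<open>C1_differentiable_on\<close>
  would demand two-sided derivatives at the end points.)
\<close>

definition velocity :: "(real \<Rightarrow> real ^ 'p ^ 'n) \<Rightarrow> real \<Rightarrow> real ^ 'p ^ 'n" where
  "velocity \<gamma> t = vector_derivative \<gamma> (at t within {0..1})"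

definition stiefel_curve :: "(real \<Rightarrow> real ^ 'p ^ 'n) \<Rightarrow> bool" where
  "stiefel_curve \<gamma> \<longleftrightarrow>
     \<gamma> ` {0..1} \<subseteq> stiefel \<and>
     (\<forall>t\<in>{0..1}. \<gamma> differentiable (at t within {0..1})) \<and>
     continuous_on {0..1} (velocity \<gamma>)"

definition beta_length :: "real \<Rightarrow> (real \<Rightarrow> real ^ 'p ^ 'n) \<Rightarrow> real" where
  "beta_length \<beta> \<gamma> = integral {0..1} (\<lambda>t. beta_norm \<beta> (\<gamma> t) (velocity \<gamma> t))"

text \<open>
  An infimum of reals; for \<open>p < n\<close> the Stiefel manifold is connected, so the set of lengths is
  nonempty for all \<open>U\<close>, \<open>V\<close> in it. (For \<open>p = n\<close> it has two components, and for points in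
  different ones the value here is a meaningless infimum over the empty set.)
\<close>

definition beta_dist :: "real \<Rightarrow> real ^ 'p ^ 'n \<Rightarrow> real ^ 'p ^ 'n \<Rightarrow> real" where
  "beta_dist \<beta> U V =
     (INF \<gamma>\<in>{\<gamma>. stiefel_curve \<gamma> \<and> \<gamma> 0 = U \<and> \<gamma> 1 = V}. beta_length \<beta> \<gamma>)"

lemma stiefel_curve_velocity_tangent:
  fixes \<gamma> :: "real \<Rightarrow> real ^ 'p ^ 'n"
  assumes \<gamma>: "stiefel_curve \<gamma>" and t: "t \<in> {0..1}"
  shows "velocity \<gamma> t \<in> stiefel_tangent (\<gamma> t)"
proof -
  let ?F = "at t within {0..1}"
  have "bilinear (\<lambda>(A :: real ^ 'p ^ 'n) B :: real ^ 'p ^ 'n. transpose A ** B)"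
    unfolding bilinear_def
    by (auto intro!: linearI simp: transpose_def matrix_matrix_mult_def vec_eq_iff
        algebra_simps sum.distrib sum_distrib_left)
  then interpret bounded_bilinear "\<lambda>(A :: real ^ 'p ^ 'n) B :: real ^ 'p ^ 'n. transpose A ** B"
    by (simp add: bilinear_conv_bounded_bilinear)
  have d: "(\<gamma> has_vector_derivative velocity \<gamma> t) ?F"
    using \<gamma> t by (simp add: stiefel_curve_def velocity_def vector_derivative_works)
  have "((\<lambda>s. transpose (\<gamma> s) ** \<gamma> s) has_vector_derivative
      (transpose (\<gamma> t) ** velocity \<gamma> t + transpose (velocity \<gamma> t) ** \<gamma> t)) ?F"
    by (rule has_vector_derivative[OF d d])
  moreover have "((\<lambda>s. transpose (\<gamma> s) ** \<gamma> s) has_vector_derivative 0) ?F"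
  proof (rule has_vector_derivative_transform[OF t])
    show "transpose (\<gamma> s) ** \<gamma> s = mat 1" if "s \<in> {0..1}" for s
      using \<gamma> that by (auto simp: stiefel_curve_def stiefel_def image_subset_iff)
    show "((\<lambda>s. mat 1 :: real ^ 'p ^ 'p) has_vector_derivative 0) ?F"
      by (rule has_vector_derivative_const)
  qed
  ultimately have "transpose (\<gamma> t) ** velocity \<gamma> t + transpose (velocity \<gamma> t) ** \<gamma> t = 0"
    using t by (auto intro: vector_derivative_unique_within_closed_interval[of 0 1 t])
  then show ?thesis
    by (simp add: stiefel_tangent_def)
qed

end

theory Submission
  imports Defs
begin

text \<open>
  Upper bound: since \<open>p < n\<close>, there is a rotation \<open>Q\<close> of determinant \<open>1\<close> with \<open>Q V = U\<close>. Write
  \<open>Q = exp A\<close> with \<open>A\<close> skew and angles \<open>\<theta>\<close> in \<open>[0, \<pi>]\<close>. The curve \<open>exp (t A) V\<close> has the constant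
  Frobenius speed \<open>\<parallel>A V\<parallel>\<close>, and comparing arc with chord in each rotation plane,
  \<open>\<theta> \<le> \<pi>/2 \<cdot> 2 sin (\<theta>/2)\<close>, gives \<open>\<parallel>A x\<parallel> \<le> \<pi>/2 \<cdot> \<parallel>Q x - x\<parallel>\<close> for every \<open>x\<close>.
  The \<open>\<beta>\<close>-norm lies between \<open>min 1 (sqrt \<beta>)\<close> and \<open>max 1 (sqrt \<beta>)\<close> times the Frobenius norm,
  and the lower bound is then the comparison of a curve with its chord.
\<close>

section \<open>Arc against chord on the unit circle\<close>

text \<open>Sine is concave on \<open>{0..pi}\<close>, so on the first half its graph lies above the
  segment from the origin to \<open>(pi / 2, 1)\<close>.\<close>

lemma two_pi_le_sin:
  fixes x :: real
  assumes "0 \<le> x" "x \<le> pi / 2"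
  shows "2 / pi * x \<le> sin x"
proof -
  have conv: "convex_on {0..pi} (\<lambda>x::real. - sin x)"
    by (rule f''_ge0_imp_convex[where f' = "\<lambda>x. - cos x" and f'' = sin])
       (auto intro!: derivative_eq_intros sin_ge_zero)
  have "- sin ((1 - 2 / pi * x) *\<^sub>R 0 + (2 / pi * x) *\<^sub>R (pi / 2)) \<le>
      (1 - 2 / pi * x) * (- sin 0) + (2 / pi * x) * (- sin (pi / 2))"
    using assms by (intro convex_onD[OF conv]) (auto simp: field_simps)
  then show ?thesis by simp
qed

text \<open>The factor \<open>2 - 2 * cos \<theta>\<close> is the squared chord of the arc \<theta>,
  that is 4 times the square of \<open>sin (\<theta> / 2)\<close>; the linear bound for sine is
  applied at the half angle. Equality holds at \<theta> = pi, which is where the constant pi/2 comes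
  from.\<close>

lemma angle_le_chord:
  fixes \<theta> :: real
  assumes "0 \<le> \<theta>" "\<theta> \<le> pi"
  shows "\<theta>\<^sup>2 \<le> (pi / 2)\<^sup>2 * (2 - 2 * cos \<theta>)"
proof -
  have "\<theta> \<le> pi * sin (\<theta> / 2)"
    using two_pi_le_sin[of "\<theta> / 2"] assms by (simp add: field_simps)
  then have "\<theta>\<^sup>2 \<le> (pi * sin (\<theta> / 2))\<^sup>2"
    using assms by (intro power_mono) auto
  moreover have "cos \<theta> = 1 - 2 * (sin (\<theta> / 2))\<^sup>2"
    using cos_double_sin[of "\<theta> / 2"] by simp
  ultimately show ?thesis
    by (simp add: power_mult_distrib power_divide)
qed

section \<open>Paths of isometries and the gluing of a plane rotation\<close>

text \<open>
  \<open>F\<close> plays the role of \<open>exp (t A)\<close> on the invariant subspace \<open>S\<close>, and \<open>F'\<close> is its time derivative.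
\<close>

definition rotation_path ::
  "'a::euclidean_space set \<Rightarrow> ('a \<Rightarrow> 'a) \<Rightarrow> (real \<Rightarrow> 'a \<Rightarrow> 'a) \<Rightarrow> (real \<Rightarrow> 'a \<Rightarrow> 'a) \<Rightarrow> bool" where
  "rotation_path S f F F' \<longleftrightarrow>
     (\<forall>t. linear (F t)) \<and>
     (\<forall>t. \<forall>x\<in>S. \<forall>y\<in>S. F t x \<bullet> F t y = x \<bullet> y) \<and>
     (\<forall>x\<in>S. F 0 x = x \<and> F 1 x = f x \<and> continuous_on UNIV (\<lambda>t. F' t x) \<and>
       (\<forall>t. F t x \<in> S \<and> F' t x \<in> S \<and> ((\<lambda>s. F s x) has_vector_derivative F' t x) (at t) \<and>
            norm (F' t x) \<le> pi / 2 * norm (f x - x)))"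

lemma inner_plane_sum:
  fixes e1 e2 z z' :: "'a::real_inner"
  assumes "e1 \<bullet> e1 = 1" "e2 \<bullet> e2 = 1" "e1 \<bullet> e2 = 0"
    and "z \<bullet> e1 = 0" "z \<bullet> e2 = 0" "z' \<bullet> e1 = 0" "z' \<bullet> e2 = 0"
  shows "(a *\<^sub>R e1 + b *\<^sub>R e2 + z) \<bullet> (a' *\<^sub>R e1 + b' *\<^sub>R e2 + z') = a * a' + b * b' + z \<bullet> z'"
  using assms by (simp add: inner_add inner_commute)

text \<open>The plane of \<open>e1\<close> and \<open>e2\<close> is turned at constant angular speed
  while the given path runs on the orthogonal complement. Speed and displacement both split
  orthogonally into these two parts, so the bound with factor pi/2 follows from the bounds on the
  parts by Pythagoras.\<close>

lemma rotation_path_plane: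
  fixes S :: "'a::euclidean_space set"
  assumes "linear f" and S: "subspace S" and e: "e1 \<in> S" "e2 \<in> S"
    and orth: "e1 \<bullet> e1 = 1" "e2 \<bullet> e2 = 1" "e1 \<bullet> e2 = 0"
    and \<theta>: "0 \<le> \<theta>" "\<theta> \<le> pi"
    and fe1: "f e1 = cos \<theta> *\<^sub>R e1 + sin \<theta> *\<^sub>R e2"
    and fe2: "f e2 = - sin \<theta> *\<^sub>R e1 + cos \<theta> *\<^sub>R e2"
    and G: "rotation_path {x\<in>S. x \<bullet> e1 = 0 \<and> x \<bullet> e2 = 0} f G G'"
  shows "\<exists>F F'. rotation_path S f F F'"
proof -
  interpret f: linear f by fact
  define T where "T = {x\<in>S. x \<bullet> e1 = 0 \<and> x \<bullet> e2 = 0}"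
  define P where "P x = x - (x \<bullet> e1) *\<^sub>R e1 - (x \<bullet> e2) *\<^sub>R e2" for x
  have linP: "linear P"
    unfolding P_def by (auto intro!: linearI simp: inner_add algebra_simps)
  have PT: "P x \<in> T" if "x \<in> S" for x
    using that e S unfolding P_def T_def
    by (auto intro!: subspace_diff subspace_scale simp: inner_diff_left orth orth(3)[unfolded inner_commute[of e1]])
  have Px: "x = (x \<bullet> e1) *\<^sub>R e1 + (x \<bullet> e2) *\<^sub>R e2 + P x" for x
    by (simp add: P_def)
  \<comment> \<open>In the plane this is the rotation by the angle \<open>t * \<theta>\<close>; the
    remaining component \<open>P x\<close> is moved by \<open>G\<close>.\<close>
  define F where "F t x = ((x \<bullet> e1) * cos (t * \<theta>) - (x \<bullet> e2) * sin (t * \<theta>)) *\<^sub>R e1 +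
    ((x \<bullet> e1) * sin (t * \<theta>) + (x \<bullet> e2) * cos (t * \<theta>)) *\<^sub>R e2 + G t (P x)" for t x
  define F' where "F' t x = (\<theta> * (- (x \<bullet> e1) * sin (t * \<theta>) - (x \<bullet> e2) * cos (t * \<theta>))) *\<^sub>R e1 +
    (\<theta> * ((x \<bullet> e1) * cos (t * \<theta>) - (x \<bullet> e2) * sin (t * \<theta>))) *\<^sub>R e2 + G' t (P x)" for t x
  note Gs = G[folded T_def, unfolded rotation_path_def]
  have linG: "linear (G t)" for t using Gs by blast
  have G01: "G 0 y = y" "G 1 y = f y" if "y \<in> T" for y using Gs that by auto
  have GT: "G t y \<in> T" "G' t y \<in> T" if "y \<in> T" for y t using Gs that by auto
  have TS: "y \<in> S" "y \<bullet> e1 = 0" "y \<bullet> e2 = 0" if "y \<in> T" for y using that by (auto simp: T_def)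
  have "linear (F t)" for t
  proof -
    have "linear (\<lambda>x. G t (P x))"
      using linear_compose[OF linP linG] by (simp add: o_def)
    then show ?thesis
      unfolding F_def
      by (intro linear_compose_add) (auto intro!: linearI simp: inner_add algebra_simps)
  qed
  moreover have "F t x \<bullet> F t y = x \<bullet> y" if "x \<in> S" "y \<in> S" for t x y
  proof -
    have "F t x \<bullet> F t y =
      ((x \<bullet> e1) * cos (t * \<theta>) - (x \<bullet> e2) * sin (t * \<theta>)) * ((y \<bullet> e1) * cos (t * \<theta>) - (y \<bullet> e2) * sin (t * \<theta>)) +
      ((x \<bullet> e1) * sin (t * \<theta>) + (x \<bullet> e2) * cos (t * \<theta>)) * ((y \<bullet> e1) * sin (t * \<theta>) + (y \<bullet> e2) * cos (t * \<theta>)) +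
      G t (P x) \<bullet> G t (P y)"
      unfolding F_def by (intro inner_plane_sum orth TS GT PT that)
    also have "G t (P x) \<bullet> G t (P y) = P x \<bullet> P y"
      using Gs PT that by blast
    also have "((x \<bullet> e1) * cos (t * \<theta>) - (x \<bullet> e2) * sin (t * \<theta>)) * ((y \<bullet> e1) * cos (t * \<theta>) - (y \<bullet> e2) * sin (t * \<theta>)) +
      ((x \<bullet> e1) * sin (t * \<theta>) + (x \<bullet> e2) * cos (t * \<theta>)) * ((y \<bullet> e1) * sin (t * \<theta>) + (y \<bullet> e2) * cos (t * \<theta>)) =
      ((x \<bullet> e1) * (y \<bullet> e1) + (x \<bullet> e2) * (y \<bullet> e2)) * ((cos (t * \<theta>))\<^sup>2 + (sin (t * \<theta>))\<^sup>2)"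
      by algebra
    also have "\<dots> + P x \<bullet> P y = (x \<bullet> e1) * (y \<bullet> e1) + (x \<bullet> e2) * (y \<bullet> e2) + P x \<bullet> P y"
      by simp
    also have "\<dots> = ((x \<bullet> e1) *\<^sub>R e1 + (x \<bullet> e2) *\<^sub>R e2 + P x) \<bullet> ((y \<bullet> e1) *\<^sub>R e1 + (y \<bullet> e2) *\<^sub>R e2 + P y)"
      by (rule inner_plane_sum[symmetric]) (intro orth TS PT that)+
    finally show ?thesis by (simp flip: Px)
  qed
  moreover have "F 0 x = x \<and> F 1 x = f x \<and> continuous_on UNIV (\<lambda>t. F' t x) \<and>
       (\<forall>t. F t x \<in> S \<and> F' t x \<in> S \<and> ((\<lambda>s. F s x) has_vector_derivative F' t x) (at t) \<and>
            norm (F' t x) \<le> pi / 2 * norm (f x - x))" if x: "x \<in> S" for x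
  proof (intro conjI allI)
    have PxT: "P x \<in> T" using x by (rule PT)
    show "F 0 x = x"
      using G01[OF PxT] by (simp add: F_def flip: Px)
    have fx: "f x = ((x \<bullet> e1) * cos \<theta> - (x \<bullet> e2) * sin \<theta>) *\<^sub>R e1 +
      ((x \<bullet> e1) * sin \<theta> + (x \<bullet> e2) * cos \<theta>) *\<^sub>R e2 + f (P x)"
      by (subst Px) (simp add: f.add f.scale fe1 fe2 algebra_simps)
    then show "F 1 x = f x"
      using G01[OF PxT] by (simp add: F_def)
    have "continuous_on UNIV (\<lambda>t. G' t (P x))" using Gs PxT by blast
    then show "continuous_on UNIV (\<lambda>t. F' t x)"
      unfolding F'_def by (intro continuous_intros)
    fix t
    show "F t x \<in> S" "F' t x \<in> S"
      unfolding F_def F'_def using S e TS(1)[OF GT(1)[OF PxT]] TS(1)[OF GT(2)[OF PxT]]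
      by (auto intro!: subspace_add subspace_scale)
    have dG: "((\<lambda>s. G s (P x)) has_vector_derivative G' t (P x)) (at t)" using Gs PxT by blast
    show "((\<lambda>s. F s x) has_vector_derivative F' t x) (at t)"
      unfolding F_def F'_def
      by (rule has_vector_derivative_add dG has_vector_derivative_scaleR[THEN has_vector_derivative_eq_rhs]
           | (rule derivative_eq_intros refl)+ | simp add: algebra_simps)+
    have GP: "norm (G' t (P x)) \<le> pi / 2 * norm (f (P x) - P x)" using Gs PxT by blast
    have "(norm (F' t x))\<^sup>2 = \<theta>\<^sup>2 * ((x \<bullet> e1)\<^sup>2 + (x \<bullet> e2)\<^sup>2) * ((cos (t * \<theta>))\<^sup>2 + (sin (t * \<theta>))\<^sup>2) + (norm (G' t (P x)))\<^sup>2"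
      unfolding power2_norm_eq_inner F'_def
      by (subst inner_plane_sum)
         ((intro orth TS GT PxT)+, algebra)
    also have "\<dots> = \<theta>\<^sup>2 * ((x \<bullet> e1)\<^sup>2 + (x \<bullet> e2)\<^sup>2) + (norm (G' t (P x)))\<^sup>2"
      by simp
    also have "\<dots> \<le> ((pi / 2)\<^sup>2 * (2 - 2 * cos \<theta>)) * ((x \<bullet> e1)\<^sup>2 + (x \<bullet> e2)\<^sup>2) + (pi / 2 * norm (f (P x) - P x))\<^sup>2"
      using angle_le_chord[OF \<theta>] GP by (intro add_mono mult_right_mono power_mono) auto
    also have "\<dots> = (pi / 2)\<^sup>2 * ((2 - 2 * cos \<theta>) * ((x \<bullet> e1)\<^sup>2 + (x \<bullet> e2)\<^sup>2) + (norm (f (P x) - P x))\<^sup>2)"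
      by (simp only: power_mult_distrib distrib_left mult.assoc)
    also have "(2 - 2 * cos \<theta>) * ((x \<bullet> e1)\<^sup>2 + (x \<bullet> e2)\<^sup>2) + (norm (f (P x) - P x))\<^sup>2 = (norm (f x - x))\<^sup>2"
    proof -
      define a b where "a = (x \<bullet> e1) * cos \<theta> - (x \<bullet> e2) * sin \<theta> - x \<bullet> e1"
        and "b = (x \<bullet> e1) * sin \<theta> + (x \<bullet> e2) * cos \<theta> - x \<bullet> e2"
      have eq: "f x - x = a *\<^sub>R e1 + b *\<^sub>R e2 + (f (P x) - P x)"
        by (subst fx) (simp add: P_def a_def b_def algebra_simps)
      \<comment> \<open>The complement is invariant under \<open>f\<close> because \<open>f\<close>
        agrees there with the end \<open>G 1\<close> of a path that stays in
        \<open>T\<close>.\<close>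
      have fP: "f (P x) \<in> T" using GT(1)[OF PxT, of 1] G01(2)[OF PxT] by simp
      have "(f x - x) \<bullet> (f x - x) = a * a + b * b + (f (P x) - P x) \<bullet> (f (P x) - P x)"
        unfolding eq by (rule inner_plane_sum) (auto simp: orth TS fP PxT inner_diff_left)
      then have "(norm (f x - x))\<^sup>2 = a\<^sup>2 + b\<^sup>2 + (norm (f (P x) - P x))\<^sup>2"
        by (simp only: power2_norm_eq_inner power2_eq_square[of a] power2_eq_square[of b])
      also have "a\<^sup>2 + b\<^sup>2 =
        ((x \<bullet> e1)\<^sup>2 + (x \<bullet> e2)\<^sup>2) * ((cos \<theta>)\<^sup>2 + (sin \<theta>)\<^sup>2 + 1 - 2 * cos \<theta>)"
        unfolding a_def b_def by algebra
      finally show ?thesis by (simp add: algebra_simps)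
    qed
    also have "(pi / 2)\<^sup>2 * (norm (f x - x))\<^sup>2 = (pi / 2 * norm (f x - x))\<^sup>2"
      by (simp only: power_mult_distrib)
    finally show "norm (F' t x) \<le> pi / 2 * norm (f x - x)"
      by (rule power2_le_imp_le) auto
  qed
  ultimately have "rotation_path S f F F'"
    unfolding rotation_path_def by blast
  then show ?thesis by blast
qed

section \<open>Splitting an isometry into plane rotations\<close>

text \<open>
  The minimality of the Rayleigh quotient \<open>x \<bullet> f x\<close> at \<open>e\<close> is used only at the two vectors
  \<open>e \<plusminus> f e\<close>; it makes \<open>e, f e\<close> span an invariant plane.
\<close>

lemma isometry_invariant_plane:
  fixes f :: "'a::real_inner \<Rightarrow> 'a"
  assumes "linear f" and S: "subspace S" and e: "e \<in> S" "e \<bullet> e = 1" and fS: "f ` S \<subseteq> S"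
    and iso: "\<And>x y. x \<in> S \<Longrightarrow> y \<in> S \<Longrightarrow> f x \<bullet> f y = x \<bullet> y"
    and min: "\<And>x. x \<in> S \<Longrightarrow> (e \<bullet> f e) * (x \<bullet> x) \<le> x \<bullet> f x"
  shows "f (f e) = (2 * (e \<bullet> f e)) *\<^sub>R f e - e"
proof -
  interpret f: linear f by fact
  define c where "c = e \<bullet> f e"
  define m where "m = e \<bullet> f (f e)"
  have fe: "f e \<in> S" "f (f e) \<in> S" using e fS by auto
  have ip: "f e \<bullet> f e = 1" "f (f e) \<bullet> f (f e) = 1" "f e \<bullet> f (f e) = c" "f e \<bullet> e = c" "f (f e) \<bullet> e = m"
    "f (f e) \<bullet> f e = c" "e \<bullet> f e = c" "e \<bullet> f (f e) = m"
    using iso fe e by (auto simp: c_def m_def inner_commute)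
  have "c * ((e + f e) \<bullet> (e + f e)) \<le> (e + f e) \<bullet> f (e + f e)"
    "c * ((e - f e) \<bullet> (e - f e)) \<le> (e - f e) \<bullet> f (e - f e)"
    using min fe e S unfolding c_def by (auto intro: subspace_add subspace_diff)
  \<comment> \<open>With the plus sign the inequality reads 2 c c \<le> m + 1, with the minus sign m
    + 1 \<le> 2 c c.\<close>
  then have m: "m = 2 * c * c - 1"
    by (simp add: f.add f.diff inner_add_left inner_add_right inner_diff_left inner_diff_right ip e algebra_simps)
  \<comment> \<open>The squared norm expands to 2 - 4 c c + 2 m, which vanishes for this
    \<open>m\<close>.\<close>
  have "(f (f e) - (2 * c) *\<^sub>R f e + e) \<bullet> (f (f e) - (2 * c) *\<^sub>R f e + e) = 0"
    by (simp add: inner_add_left inner_add_right inner_diff_left inner_diff_right ip e algebra_simps m)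
  then have "f (f e) - (2 * c) *\<^sub>R f e + e = 0"
    by (simp only: inner_eq_zero_iff)
  then show ?thesis
    unfolding c_def by (simp add: algebra_simps)
qed

text \<open>The constant path; it serves the zero subspace and the case where the Rayleigh minimum
  is 1.\<close>

lemma rotation_path_identity:
  assumes "\<And>x. x \<in> S \<Longrightarrow> f x = x" "subspace S"
  shows "\<exists>F F'. rotation_path S f F F'"
proof -
  have "rotation_path S f (\<lambda>t x. x) (\<lambda>t x. 0)"
    using assms by (auto simp: rotation_path_def linear_iff subspace_0)
  then show ?thesis by blast
qed

text \<open>
  Eigenvectors for \<open>-1\<close> are paired up into half turns; the second alternative is the one left over
  when there is an odd number of them.
\<close>

lemma rotation_path_or_reflection:
  fixes f :: "'a::euclidean_space \<Rightarrow> 'a"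
  assumes "linear f"
  shows "subspace S \<Longrightarrow> f ` S \<subseteq> S \<Longrightarrow> (\<And>x y. x \<in> S \<Longrightarrow> y \<in> S \<Longrightarrow> f x \<bullet> f y = x \<bullet> y) \<Longrightarrow>
    (\<exists>F F'. rotation_path S f F F') \<or>
    (\<exists>e\<in>S. e \<bullet> e = 1 \<and> f e = - e \<and> (\<exists>F F'. rotation_path {x\<in>S. x \<bullet> e = 0} f F F'))"
proof (induction "dim S" arbitrary: S rule: less_induct)
  case less
  interpret f: linear f by fact
  note S = \<open>subspace S\<close> and iso = less.prems(3)
  have fS: "f x \<in> S" if "x \<in> S" for x using less.prems(2) that by auto
  show ?case
  proof (cases "S = {0}")
    case True
    then show ?thesis using rotation_path_identity[of S f] S by auto
  next
    case False
    then obtain x0 where x0: "x0 \<in> S" "x0 \<noteq> 0" using subspace_0[OF S] by auto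
    \<comment> \<open>The Rayleigh quotient attains its minimum on the compact unit sphere of
      \<open>S\<close>. The minimum \<open>c\<close> is the cosine of the largest rotation angle of
      \<open>f\<close> on \<open>S\<close>.\<close>
    define K where "K = sphere 0 1 \<inter> S"
    have "x0 /\<^sub>R norm x0 \<in> K"
      using x0 S by (auto simp: K_def subspace_scale)
    then have "K \<noteq> {}" by auto
    moreover have "compact K"
      unfolding K_def using closed_subspace[OF S] by (intro compact_Int_closed) auto
    moreover have "continuous_on K (\<lambda>x. x \<bullet> f x)"
      using \<open>linear f\<close> by (intro continuous_intros linear_continuous_on) (simp add: linear_conv_bounded_linear)
    ultimately obtain e where eK: "e \<in> K" and minK: "\<And>x. x \<in> K \<Longrightarrow> e \<bullet> f e \<le> x \<bullet> f x"
      using continuous_attains_inf by metis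
    have e: "e \<in> S" "e \<bullet> e = 1" using eK by (auto simp: K_def norm_eq_1)
    define c where "c = e \<bullet> f e"
    have min: "c * (x \<bullet> x) \<le> x \<bullet> f x" if "x \<in> S" for x
    proof (cases "x = 0")
      case False
      have "x /\<^sub>R norm x \<in> K" using that False S by (auto simp: K_def subspace_scale)
      from minK[OF this] have "c \<le> (x \<bullet> f x) / (x \<bullet> x)"
        by (simp add: c_def f.scale divide_simps power2_norm_eq_inner[symmetric] power2_eq_square)
      then show ?thesis using False by (simp add: field_simps)
    qed auto
    have fe: "f e \<in> S" "f e \<bullet> f e = 1" using e fS iso by auto
    have "\<bar>c\<bar> \<le> 1"
      using Cauchy_Schwarz_ineq2[of e "f e"] e fe by (simp add: c_def norm_eq_sqrt_inner)
    \<comment> \<open>The three cases are: \<open>f\<close> is the identity on \<open>S\<close>,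
      \<open>f\<close> reverses \<open>e\<close>, or \<open>e\<close> and \<open>f e\<close> span a
      plane turned by an angle strictly between 0 and pi.\<close>
    then consider "c = 1" | "c = -1" | "-1 < c" "c < 1" by linarith
    then show ?thesis
    proof cases
      case 1
      have "f x = x" if "x \<in> S" for x
      proof -
        have "(f x - x) \<bullet> (f x - x) = 2 * (x \<bullet> x - x \<bullet> f x)"
          using iso[OF that that] by (simp add: inner_diff inner_commute)
        also have "\<dots> \<le> 0" using min[OF that] 1 by simp
        finally have "(f x - x) \<bullet> (f x - x) = 0" using inner_ge_zero[of "f x - x"] by linarith
        then show ?thesis by simp
      qed
      then show ?thesis using rotation_path_identity[of S f] S by blast
    next
      case 2
      have "(f e + e) \<bullet> (f e + e) = 0"
        using fe e 2 by (simp add: inner_add inner_commute c_def)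
      then have fe': "f e = - e" by (simp add: eq_neg_iff_add_eq_0)
      define S1 where "S1 = {x\<in>S. x \<bullet> e = 0}"
      have S1: "subspace S1" using S unfolding S1_def subspace_def by (auto simp: inner_add)
      have "S1 \<subseteq> S" "e \<notin> S1" using e(2) by (auto simp: S1_def)
      then have "S1 \<subset> S" using e(1) by blast
      then have "dim S1 < dim S" using S S1 by (metis dim_psubset span_eq_iff)
      moreover have "f ` S1 \<subseteq> S1"
      proof
        fix y assume "y \<in> f ` S1"
        then obtain x where x: "y = f x" "x \<in> S" "x \<bullet> e = 0" by (auto simp: S1_def)
        have "f x \<bullet> e = - (f x \<bullet> f e)" by (simp add: fe')
        also have "\<dots> = 0" using iso x e by simp
        finally show "y \<in> S1" using x fS by (simp add: S1_def)
      qed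
      ultimately consider "\<exists>F F'. rotation_path S1 f F F'"
        | u F F' where "u \<in> S1" "u \<bullet> u = 1" "f u = - u" "rotation_path {x\<in>S1. x \<bullet> u = 0} f F F'"
        using less.hyps[of S1] S1 iso unfolding S1_def by blast
      then show ?thesis
      proof cases
        case 1
        then show ?thesis using e fe' unfolding S1_def by blast
      next
        case 2
        have eq: "{x\<in>S1. x \<bullet> u = 0} = {x\<in>S. x \<bullet> e = 0 \<and> x \<bullet> u = 0}" by (auto simp: S1_def)
        \<comment> \<open>Here both \<open>e\<close> and \<open>u\<close> are reversed, so on their
          plane \<open>f\<close> is the rotation by pi, and the path on the complement of both
          vectors can be glued to it.\<close>
        have "\<exists>F F'. rotation_path S f F F'"
          by (rule rotation_path_plane[OF \<open>linear f\<close> S e(1) _ e(2) 2(2), of pi])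
            (use 2 fe' in \<open>auto simp: S1_def eq inner_commute\<close>)
        then show ?thesis ..
      qed
    next
      case 3
      define s where "s = sqrt (1 - c\<^sup>2)"
      have "c\<^sup>2 < 1" using 3 by (simp add: abs_square_less_1)
      then have s: "s > 0" "s * s = 1 - c * c" by (auto simp: s_def power2_eq_square)
      define \<theta> where "\<theta> = arccos c"
      have \<theta>: "0 \<le> \<theta>" "\<theta> \<le> pi" "cos \<theta> = c" "sin \<theta> = s"
        using 3 by (auto simp: \<theta>_def s_def arccos_lbound arccos_ubound sin_arccos)
      \<comment> \<open>Gram-Schmidt applied to \<open>f e\<close>: its component orthogonal to
        \<open>e\<close> has length \<open>s\<close>, the sine of the rotation angle.\<close>
      define e2 where "e2 = (1 / s) *\<^sub>R (f e - c *\<^sub>R e)"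
      have ffe: "f (f e) = (2 * c) *\<^sub>R f e - e"
        unfolding c_def
        by (rule isometry_invariant_plane[OF \<open>linear f\<close> S e less.prems(2)]) (use iso min c_def in auto)
      have fe1: "f e = c *\<^sub>R e + s *\<^sub>R e2" using s by (simp add: e2_def)
      \<comment> \<open>The image of \<open>e2\<close> is found from the relation for
        \<open>f (f e)\<close>; everything is multiplied by \<open>s\<close> first, so that no
        division occurs, and \<open>s\<close> is cancelled afterwards.\<close>
      have "s *\<^sub>R f e2 = s *\<^sub>R (- s *\<^sub>R e + c *\<^sub>R e2)"
      proof -
        have "s *\<^sub>R e2 = f e - c *\<^sub>R e" using s(1) by (simp add: e2_def)
        then have "f (s *\<^sub>R e2) = f (f e - c *\<^sub>R e)" by (rule arg_cong)
        then have "s *\<^sub>R f e2 = f (f e) - c *\<^sub>R f e" by (simp only: f.scale f.diff)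
        also have "\<dots> = (2 * c - c) *\<^sub>R f e - e"
          by (simp only: ffe scaleR_left_diff_distrib) (simp only: diff_diff_eq add.commute)
        also have "\<dots> = c *\<^sub>R f e - e" by simp
        also have "\<dots> = c *\<^sub>R (c *\<^sub>R e + s *\<^sub>R e2) - e"
          by (simp only: fe1)
        also have "\<dots> = (c * c - 1) *\<^sub>R e + (s * c) *\<^sub>R e2" by (simp add: algebra_simps)
        also have "c * c - 1 = - (s * s)" using s(2) by linarith
        finally show ?thesis by (simp add: scaleR_right_distrib scaleR_right_diff_distrib)
      qed
      then have fe2: "f e2 = - s *\<^sub>R e + c *\<^sub>R e2" using s by (simp only: scaleR_cancel_left) auto
      have e2S: "e2 \<in> S" using e fe S by (auto simp: e2_def intro!: subspace_scale subspace_diff)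
      have e_e2: "e \<bullet> e2 = 0" using e by (simp add: e2_def inner_diff_right c_def)
      have "s * s * (e2 \<bullet> e2) = (f e - c *\<^sub>R e) \<bullet> (f e - c *\<^sub>R e)"
        using s(1) by (simp add: e2_def)
      also have "\<dots> = s * s"
        using e fe by (simp add: inner_diff_left inner_diff_right inner_commute c_def s(2))
      finally have e2: "e2 \<bullet> e2 = 1" using s(1) by simp
      define S1 where "S1 = {x\<in>S. x \<bullet> e = 0 \<and> x \<bullet> e2 = 0}"
      have S1: "subspace S1" using S unfolding S1_def subspace_def by (auto simp: inner_add)
      have "S1 \<subseteq> S" "e \<notin> S1" using e(2) by (auto simp: S1_def)
      then have "S1 \<subset> S" using e(1) by blast
      then have "dim S1 < dim S" using S S1 by (metis dim_psubset span_eq_iff)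
      moreover have "f ` S1 \<subseteq> S1"
      proof
        fix y assume "y \<in> f ` S1"
        then obtain x where x: "y = f x" "x \<in> S" "x \<bullet> e = 0" "x \<bullet> e2 = 0" by (auto simp: S1_def)
        \<comment> \<open>Inverting the plane rotation writes \<open>e\<close>, and below
          \<open>e2\<close>, as combinations of \<open>f e\<close> and \<open>f e2\<close>. Since
          \<open>f\<close> preserves inner products, \<open>f x\<close> is then orthogonal to the
          plane whenever \<open>x\<close> is.\<close>
        have "e = (c * c + s * s) *\<^sub>R e" using s by simp
        also have "\<dots> = c *\<^sub>R f e - s *\<^sub>R f e2" by (simp add: fe1 fe2 algebra_simps)
        finally have "f x \<bullet> e = c * (f x \<bullet> f e) - s * (f x \<bullet> f e2)"
          by (metis inner_diff_right inner_scaleR_right)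
        moreover have "e2 = (c * c + s * s) *\<^sub>R e2" using s by simp
        then have "e2 = s *\<^sub>R f e + c *\<^sub>R f e2" by (simp add: fe1 fe2 algebra_simps)
        then have "f x \<bullet> e2 = s * (f x \<bullet> f e) + c * (f x \<bullet> f e2)"
          by (metis inner_add_right inner_scaleR_right)
        ultimately show "y \<in> S1" using x fS iso e e2S by (simp add: S1_def)
      qed
      ultimately consider F F' where "rotation_path S1 f F F'"
        | u F F' where "u \<in> S1" "u \<bullet> u = 1" "f u = - u" "rotation_path {x\<in>S1. x \<bullet> u = 0} f F F'"
        using less.hyps[of S1] S1 iso unfolding S1_def by blast
      then show ?thesis
      proof cases
        case 1
        then have "\<exists>F F'. rotation_path S f F F'"
          unfolding S1_def
          by (intro rotation_path_plane[OF \<open>linear f\<close> S e(1) e2S e(2) e2 e_e2 \<theta>(1,2)])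
            (simp_all add: \<theta> fe1 fe2)
        then show ?thesis ..
      next
        case 2
        \<comment> \<open>The reversed vector \<open>u\<close> is orthogonal to the plane, so the
          plane is added to the path on the complement of \<open>u\<close>, and \<open>u\<close>
          itself remains as the leftover in \<open>S\<close>.\<close>
        let ?S2 = "{x\<in>S. x \<bullet> u = 0}"
        have eq: "{x\<in>S1. x \<bullet> u = 0} = {x\<in>?S2. x \<bullet> e = 0 \<and> x \<bullet> e2 = 0}" by (auto simp: S1_def)
        have S2: "subspace ?S2" using S unfolding subspace_def by (auto simp: inner_add)
        have "e \<in> ?S2" "e2 \<in> ?S2" using 2(1) e e2S by (auto simp: S1_def inner_commute)
        then have "\<exists>F F'. rotation_path ?S2 f F F'"
          using 2(4) unfolding eq
          by (intro rotation_path_plane[OF \<open>linear f\<close> S2 _ _ e(2) e2 e_e2 \<theta>(1,2)])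
            (simp_all add: \<theta> fe1 fe2)
        then show ?thesis using 2 by (auto simp: S1_def)
      qed
    qed
  qed
qed

section \<open>Determinants exclude a leftover reflection\<close>

lemma linear_reflection: "linear (\<lambda>x. x - (2 * (x \<bullet> e)) *\<^sub>R e)"
  by (rule linearI) (simp_all add: inner_add_left algebra_simps)

text \<open>An orthogonal matrix \<open>A\<close> taking a coordinate axis to \<open>e\<close>
  conjugates the reflection into the diagonal matrix \<open>D\<close> with a single entry
  -1.\<close>

lemma det_reflection:
  fixes e :: "real ^ 'n"
  assumes "e \<bullet> e = 1"
  shows "det (matrix (\<lambda>x. x - (2 * (x \<bullet> e)) *\<^sub>R e)) = -1"
proof -
  fix k :: 'n
  obtain A :: "real ^ 'n ^ 'n" where A: "orthogonal_matrix A" "A *v axis k 1 = e"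
    using orthogonal_matrix_exists_basis[of e k] assms by (auto simp: norm_eq_1)
  define D :: "real ^ 'n ^ 'n" where "D = (\<chi> i j. if i = j then (if i = k then -1 else 1) else 0)"
  have D: "D *v y = y - (2 * y $ k) *\<^sub>R axis k 1" for y
    by (auto simp: D_def matrix_vector_mult_def vec_eq_iff axis_def if_distrib[of "\<lambda>a. a * _"] cong: if_cong)
  have "A *v (D *v (transpose A *v x)) = x - (2 * (x \<bullet> e)) *\<^sub>R e" for x
  proof -
    have "(transpose A *v x) $ k = (transpose A *v x) \<bullet> axis k 1"
      by (simp add: inner_axis)
    also have "\<dots> = x \<bullet> (A *v axis k 1)"
      by (metis dot_lmul_matrix transpose_matrix_vector)
    finally have k: "(transpose A *v x) $ k = x \<bullet> e" using A by simp
    have "A *v (transpose A *v x) = x"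
      using A(1) by (simp only: matrix_vector_mul_assoc orthogonal_matrix_def matrix_vector_mul_lid)
    then show ?thesis
      by (simp only: D k matrix_vector_mult_diff_distrib matrix_vector_mult_scaleR A(2))
  qed
  then have "(\<lambda>x. x - (2 * (x \<bullet> e)) *\<^sub>R e) = (*v) (A ** D ** transpose A)"
    by (simp only: fun_eq_iff matrix_vector_mul_assoc matrix_mul_assoc) simp
  then have "det (matrix (\<lambda>x. x - (2 * (x \<bullet> e)) *\<^sub>R e)) = det A * det A * det D"
    by (simp add: det_mul)
  also have "det A * det A = 1"
    using det_orthogonal_matrix[OF A(1)] by auto
  also have "det D = (\<Prod>i\<in>UNIV. D $ i $ i)"
    by (rule det_diagonal) (simp add: D_def)
  also have "\<dots> = -1"
    by (simp add: D_def prod.If_cases)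
  finally show ?thesis by simp
qed

lemma continuous_det_path:
  fixes H :: "real \<Rightarrow> real ^ 'n \<Rightarrow> real ^ 'n"
  assumes "\<And>x. continuous_on S (\<lambda>t. H t x)"
  shows "continuous_on S (\<lambda>t. det (matrix (H t)))"
  unfolding det_def matrix_def vec_lambda_beta
  by (intro continuous_on_sum continuous_on_mult continuous_on_const continuous_on_prod
      continuous_on_component assms)

text \<open>Along the path the determinant is continuous and takes only the values 1 and -1. It
  starts at 1, so by the intermediate value theorem it cannot change sign.\<close>

lemma det_isometry_path:
  fixes H :: "real \<Rightarrow> real ^ 'n \<Rightarrow> real ^ 'n"
  assumes orth: "\<And>t. orthogonal_transformation (H t)"
    and cont: "\<And>x. continuous_on UNIV (\<lambda>t. H t x)"
    and H0: "H 0 = id"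
  shows "det (matrix (H 1)) = 1"
proof (rule ccontr)
  have pm: "det (matrix (H t)) = 1 \<or> det (matrix (H t)) = -1" for t
    using orthogonal_transformation_det[OF orth[of t]] by linarith
  assume "det (matrix (H 1)) \<noteq> 1"
  then have "det (matrix (H 1)) \<le> 0" using pm[of 1] by auto
  moreover have "0 \<le> det (matrix (H 0))" by (simp add: H0 matrix_id_mat_1)
  moreover have "continuous_on {0..1} (\<lambda>t. det (matrix (H t)))"
    by (rule continuous_on_subset[OF continuous_det_path[OF cont] subset_UNIV])
  ultimately obtain t where "det (matrix (H t)) = 0"
    using IVT2'[of "\<lambda>t. det (matrix (H t))" 1 0 0] by auto
  then show False using pm[of t] by auto
qed

text \<open>Without a path, a reversed unit vector \<open>e\<close> is left over, with a path on its
  complement. That path, extended by fixing \<open>e\<close>, ends in an isometry \<open>H 1\<close>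
  of determinant 1, and \<open>f\<close> is the reflection in \<open>e\<close> followed by
  \<open>H 1\<close>. Hence \<open>f\<close> would have determinant -1.\<close>

lemma rotation_path_UNIV:
  fixes f :: "real ^ 'n \<Rightarrow> real ^ 'n"
  assumes f: "orthogonal_transformation f" and det: "det (matrix f) = 1"
  shows "\<exists>F F'. rotation_path UNIV f F F'"
proof (rule ccontr)
  assume no: "\<nexists>F F'. rotation_path UNIV f F F'"
  have "linear f" and iso: "\<And>x y. f x \<bullet> f y = x \<bullet> y"
    using f by (auto simp: orthogonal_transformation_def)
  interpret f: linear f by fact
  obtain e F F' where e: "e \<bullet> e = 1" "f e = - e" and F: "rotation_path {x. x \<bullet> e = 0} f F F'"
    using rotation_path_or_reflection[OF \<open>linear f\<close>, of UNIV] iso no by auto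
  define P where "P x = x - (x \<bullet> e) *\<^sub>R e" for x
  have Pe: "P x \<bullet> e = 0" "e \<bullet> P x = 0" for x
    using e by (auto simp: P_def inner_diff inner_commute)
  define H where "H t x = F t (P x) + (x \<bullet> e) *\<^sub>R e" for t x
  have linP: "linear P"
    unfolding P_def by (auto intro!: linearI simp: inner_add algebra_simps)
  have linF: "linear (F t)" for t
    using F unfolding rotation_path_def by blast
  have F01: "F 0 (P x) = P x" "F 1 (P x) = f (P x)" for x
    using F Pe unfolding rotation_path_def by auto
  have F_der: "((\<lambda>s. F s (P x)) has_vector_derivative F' t (P x)) (at t)" for t x
    using F Pe unfolding rotation_path_def by auto
  have FT: "F t (P x) \<bullet> e = 0" "e \<bullet> F t (P x) = 0" for t x
    using F Pe[of x] unfolding rotation_path_def by (auto simp: inner_commute)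
  have FF: "F t (P x) \<bullet> F t (P y) = P x \<bullet> P y" for t x y
    using F Pe unfolding rotation_path_def by auto
  have "linear (H t)" for t
    using linear_compose[OF linP linF, of t] unfolding H_def
    by (intro linear_compose_add) (auto intro!: linearI simp: o_def inner_add algebra_simps)
  moreover have "H t x \<bullet> H t y = x \<bullet> y" for t x y
  proof -
    have "H t x \<bullet> H t y = P x \<bullet> P y + (x \<bullet> e) * (y \<bullet> e)"
      by (simp add: H_def inner_add_left inner_add_right FT FF e)
    also have "\<dots> = x \<bullet> y"
      by (simp add: P_def inner_diff_left inner_diff_right e inner_commute)
    finally show ?thesis .
  qed
  ultimately have "orthogonal_transformation (H t)" for t
    by (simp add: orthogonal_transformation_def)
  moreover have "continuous_on UNIV (\<lambda>t. H t x)" for x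
  proof -
    have "isCont (\<lambda>t. F t (P x)) t" for t
      using has_vector_derivative_continuous[OF F_der] .
    then have "continuous_on UNIV (\<lambda>t. F t (P x))"
      by (simp add: continuous_on_eq_continuous_at)
    then show ?thesis unfolding H_def by (intro continuous_intros)
  qed
  moreover have "H 0 = id"
    by (simp add: H_def fun_eq_iff F01) (simp add: P_def)
  ultimately have H1: "det (matrix (H 1)) = 1" "linear (H 1)"
    using det_isometry_path[of H] by (auto simp: orthogonal_transformation_def)
  let ?r = "\<lambda>x. x - (2 * (x \<bullet> e)) *\<^sub>R e"
  \<comment> \<open>The reflection only changes the sign of the component along \<open>e\<close>,
    and \<open>H 1\<close> agrees with \<open>f\<close> on the complement of
    \<open>e\<close>.\<close>
  have "f x = H 1 (?r x)" for x
  proof -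
    have re: "?r x \<bullet> e = - (x \<bullet> e)" by (simp add: inner_diff_left e)
    have "x - (2 * a) *\<^sub>R e + a *\<^sub>R e = x - (2 * a - a) *\<^sub>R e" for a
      by (simp only: scaleR_left_diff_distrib) simp
    then have "P (?r x) = P x" by (simp add: P_def re)
    moreover note re
    moreover have "F 1 (P x) = f (P x)" using F01 by blast
    moreover have "f (P x) = f x + (x \<bullet> e) *\<^sub>R e"
      by (simp add: P_def f.diff f.scale e)
    ultimately show ?thesis
      by (simp only: H_def) simp
  qed
  then have "f = H 1 \<circ> ?r" unfolding o_def by (rule ext)
  then have "matrix f = matrix (H 1 \<circ> ?r)" by (rule arg_cong)
  also have "\<dots> = matrix (H 1) ** matrix ?r"
    by (rule matrix_compose) (rule linear_reflection H1)+
  finally show False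
    using det det_reflection[OF e(1)] H1 by (simp add: det_mul)
qed

section \<open>Extending a pair of orthonormal frames to a rotation\<close>

lemma stiefel_vec_eq:
  assumes "U \<in> stiefel"
  shows "transpose U *v (U *v y) = y" "(U *v x) \<bullet> (U *v y) = x \<bullet> y"
proof -
  have U: "transpose U ** U = mat 1" using assms by (simp add: stiefel_def)
  then show *: "transpose U *v (U *v y) = y" for y by (simp add: matrix_vector_mul_assoc)
  show "(U *v x) \<bullet> (U *v y) = x \<bullet> y"
    by (metis * dot_lmul_matrix inner_commute transpose_matrix_vector)
qed

text \<open>The column spaces of \<open>U\<close> and \<open>V\<close> have complements of equal
  dimension n - p, hence there is an isometry \<open>h\<close> between the complements. It is
  combined with the map between the column spaces that sends \<open>V *v y\<close> to
  \<open>U *v y\<close>.\<close>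

lemma isometry_extending_stiefel:
  fixes U V :: "real ^ 'p ^ 'n"
  assumes U: "U \<in> stiefel" and V: "V \<in> stiefel"
  shows "\<exists>f. orthogonal_transformation f \<and> (\<forall>y. f (V *v y) = U *v y)"
proof -
  define C where "C W = {y\<in>UNIV. \<forall>x\<in>range ((*v) W). orthogonal x y}" for W :: "real ^ 'p ^ 'n"
  have subspC: "subspace (C W)" for W
    unfolding C_def subspace_def by (auto simp: orthogonal_clauses orthogonal_def inner_add)
  have dimC: "dim (C W) + CARD('p) = CARD('n)" if "W \<in> stiefel" for W
  proof -
    have "inj ((*v) W)" by (metis injI stiefel_vec_eq(1)[OF that])
    then have "dim (range ((*v) W)) = CARD('p)"
      using dim_image_eq[of "(*v) W" UNIV] by simp
    then show ?thesis
      using dim_subspace_orthogonal_to_vectors[of "range ((*v) W)" UNIV]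
      by (simp add: C_def linear_subspace_image)
  qed
  obtain h where h: "linear h" "h ` C V = C U" "\<And>x. x \<in> C V \<Longrightarrow> norm (h x) = norm x"
    using isometry_subspaces[OF subspC[of V] subspC[of U]] dimC[OF U] dimC[OF V] by auto
  interpret h: linear h by fact
  \<comment> \<open>Since \<open>V\<close> has orthonormal columns, \<open>V ** transpose V\<close>
    is the orthogonal projection onto its column space; \<open>P\<close> projects onto the
    complement.\<close>
  define P where "P x = x - V *v (transpose V *v x)" for x
  define f where "f x = U *v (transpose V *v x) + h (P x)" for x
  have adj: "(V *v y) \<bullet> x = y \<bullet> (transpose V *v x)" for x y
    by (metis dot_lmul_matrix inner_commute transpose_matrix_vector)
  have "(V *v y) \<bullet> P x = 0" for x y
    by (simp only: P_def inner_diff_right adj stiefel_vec_eq(1)[OF V] diff_self)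
  then have PC: "P x \<in> C V" for x
    by (auto simp: C_def orthogonal_def)
  have linP: "linear P"
    unfolding P_def by (intro linear_compose_sub linear_ident) (simp_all only: matrix_vector_mul_assoc matrix_vector_mul_linear)
  have "linear f"
    unfolding f_def using linear_compose[OF linP h(1)]
    by (intro linear_compose_add) (simp_all only: matrix_vector_mul_assoc matrix_vector_mul_linear o_def)
  moreover have "norm (f x) = norm x" for x
  proof -
    have o: "orthogonal (U *v a) (h (P x))" for a using h(2) PC[of x] by (auto simp: C_def)
    have o': "orthogonal (V *v a) (P x)" for a using PC[of x] by (auto simp: C_def)
    have nW: "norm (W *v a) = norm a" if "W \<in> stiefel" for W :: "real ^ 'p ^ 'n" and a
      using stiefel_vec_eq(2)[OF that, of a a] by (simp add: norm_eq)
    have "(norm (f x))\<^sup>2 = (norm (V *v (transpose V *v x)))\<^sup>2 + (norm (P x))\<^sup>2"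
      unfolding f_def by (simp add: norm_add_Pythagorean[OF o] nW U V h PC)
    also have "\<dots> = (norm (V *v (transpose V *v x) + P x))\<^sup>2"
      by (rule norm_add_Pythagorean[OF o', symmetric])
    also have "\<dots> = (norm x)\<^sup>2" by (simp add: P_def)
    finally show ?thesis by simp
  qed
  ultimately have "orthogonal_transformation f" by (simp add: orthogonal_transformation)
  moreover have "f (V *v y) = U *v y" for y
    by (simp only: f_def P_def stiefel_vec_eq(1)[OF V]) (simp add: h.zero)
  ultimately show ?thesis by blast
qed

text \<open>If the extension has determinant -1, it is preceded by the reflection in a unit vector
  orthogonal to all columns of \<open>V\<close>, which exists because p < n. This flips the
  determinant and leaves the values on the column space of \<open>V\<close> unchanged.\<close>

lemma rotation_extending_stiefel:
  fixes U V :: "real ^ 'p ^ 'n"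
  assumes U: "U \<in> stiefel" and V: "V \<in> stiefel" and less: "CARD('p) < CARD('n)"
  shows "\<exists>f. orthogonal_transformation f \<and> det (matrix f) = 1 \<and> (\<forall>y. f (V *v y) = U *v y)"
proof -
  obtain f where f: "orthogonal_transformation f" "\<And>y. f (V *v y) = U *v y"
    using isometry_extending_stiefel[OF U V] by blast
  show ?thesis
  proof (cases "det (matrix f) = 1")
    case False
    then have det: "det (matrix f) = -1"
      using orthogonal_transformation_det[OF f(1)] by linarith
    have "dim (range ((*v) V)) \<le> CARD('p)"
      using dim_image_le[of "(*v) V" UNIV] by simp
    then have "dim (range ((*v) V)) < DIM(real ^ 'n)" using less by simp
    then obtain w where w: "w \<noteq> 0" "\<And>x. x \<in> span (range ((*v) V)) \<Longrightarrow> orthogonal w x"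
      using orthogonal_to_subspace_exists by blast
    define e where "e = w /\<^sub>R norm w"
    have "norm e = 1" using w(1) by (simp add: e_def)
    then have e: "e \<bullet> e = 1" by (simp only: norm_eq_1)
    have eV: "(V *v y) \<bullet> e = 0" for y
      using w(2)[of "V *v y"] by (simp add: e_def orthogonal_def inner_commute span_base)
    let ?r = "\<lambda>x. x - (2 * (x \<bullet> e)) *\<^sub>R e"
    have linr: "linear ?r" by (rule linear_reflection)
    moreover have "?r x \<bullet> ?r y = x \<bullet> y" for x y
      by (simp add: inner_diff_left inner_diff_right e inner_commute)
    ultimately have "orthogonal_transformation ?r" by (simp add: orthogonal_transformation_def)
    then have "orthogonal_transformation (f \<circ> ?r)" by (intro orthogonal_transformation_compose f)
    moreover have "matrix (f \<circ> ?r) = matrix f ** matrix ?r"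
      using f(1) linr by (intro matrix_compose) (auto simp: orthogonal_transformation_def)
    then have "det (matrix (f \<circ> ?r)) = 1"
      using det det_reflection[OF e] by (simp add: det_mul)
    moreover have "(f \<circ> ?r) (V *v y) = U *v y" for y by (simp add: eV f)
    ultimately show ?thesis by blast
  qed (use f in blast)
qed

section \<open>The \<beta>-norm against the Frobenius norm\<close>

lemma inner_eq_trace:
  fixes A B :: "real ^ 'p ^ 'n"
  shows "A \<bullet> B = trace (transpose A ** B)"
proof -
  have "trace (transpose A ** B) = (\<Sum>j\<in>UNIV. \<Sum>i\<in>UNIV. A $ i $ j * B $ i $ j)"
    by (simp add: trace_def matrix_matrix_mult_def transpose_def)
  also have "\<dots> = (\<Sum>i\<in>UNIV. \<Sum>j\<in>UNIV. A $ i $ j * B $ i $ j)"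
    by (rule sum.swap)
  finally show ?thesis by (simp add: inner_vec_def)
qed

lemma inner_eq_columns:
  fixes A B :: "real ^ 'p ^ 'n"
  shows "A \<bullet> B = (\<Sum>j\<in>UNIV. column j A \<bullet> column j B)"
  by (simp add: inner_vec_def column_def) (rule sum.swap)

lemma beta_inner_eq:
  "beta_inner \<beta> U D D = (norm D)\<^sup>2 - (1 - \<beta>) * (norm (transpose U ** D))\<^sup>2"
proof -
  let ?K = "(1 - \<beta>) *\<^sub>R (U ** transpose U)"
  have "(mat 1 - ?K) ** D = mat 1 ** D - ?K ** D"
    by (simp only: matrix_matrix_mult_def vec_eq_iff vec_lambda_beta vector_minus_component
        left_diff_distrib sum_subtractf) simp
  moreover have "?K ** D = (1 - \<beta>) *\<^sub>R (U ** (transpose U ** D))"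
    by (simp add: matrix_mul_assoc flip: scalar_matrix_assoc)
  ultimately have K: "(mat 1 - ?K) ** D = D - (1 - \<beta>) *\<^sub>R (U ** (transpose U ** D))"
    by simp
  have "D \<bullet> (U ** (transpose U ** D)) = (norm (transpose U ** D))\<^sup>2"
    by (simp add: power2_norm_eq_inner inner_eq_trace matrix_transpose_mul matrix_mul_assoc)
  moreover have "beta_inner \<beta> U D D = D \<bullet> ((mat 1 - ?K) ** D)"
    by (simp add: beta_inner_def inner_eq_trace matrix_mul_assoc)
  ultimately show ?thesis
    by (simp add: K inner_diff_right power2_norm_eq_inner)
qed

text \<open>\<open>U ** transpose U\<close> is an orthogonal projection, so the difference of the
  squared norms is the squared norm of the residual \<open>D - U ** W\<close>.\<close>

lemma norm_transpose_stiefel_le: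
  assumes U: "U \<in> stiefel"
  shows "norm (transpose U ** D) \<le> norm D"
proof -
  define W where "W = transpose U ** D"
  have "D \<bullet> (U ** W) = W \<bullet> W"
    by (simp add: inner_eq_trace W_def matrix_transpose_mul matrix_mul_assoc)
  moreover have "(U ** W) \<bullet> (U ** W) = W \<bullet> W"
  proof -
    have "transpose (U ** W) ** (U ** W) = transpose W ** (transpose U ** U) ** W"
      by (simp add: matrix_transpose_mul matrix_mul_assoc)
    then show ?thesis using U by (simp add: inner_eq_trace stiefel_def)
  qed
  ultimately have "(D - U ** W) \<bullet> (D - U ** W) = D \<bullet> D - W \<bullet> W"
    by (simp add: inner_diff inner_commute)
  then have "W \<bullet> W \<le> D \<bullet> D" by (metis diff_ge_0_iff_ge inner_ge_zero)
  then show ?thesis by (simp add: norm_eq_sqrt_inner W_def)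
qed

text \<open>The squared \<beta>-norm is (x - y) + \<beta> y, where both x - y and y are nonnegative
  and add up to the squared Frobenius norm x. It therefore lies between the smaller and the larger
  of the weights 1 and \<beta>, times x.\<close>

lemma beta_norm_bounds:
  assumes U: "U \<in> stiefel" and "\<beta> > 0"
  shows "min 1 (sqrt \<beta>) * norm D \<le> beta_norm \<beta> U D"
    and "beta_norm \<beta> U D \<le> max 1 (sqrt \<beta>) * norm D"
proof -
  define x where "x = (norm D)\<^sup>2"
  define y where "y = (norm (transpose U ** D))\<^sup>2"
  have xy: "0 \<le> y" "y \<le> x"
    using norm_transpose_stiefel_le[OF U, of D] by (auto simp: x_def y_def intro: power_mono)
  have eq: "beta_inner \<beta> U D D = x - (1 - \<beta>) * y" by (simp add: beta_inner_eq x_def y_def)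
  have "min 1 \<beta> * (x - y) \<le> 1 * (x - y)" "min 1 \<beta> * y \<le> \<beta> * y"
    "1 * (x - y) \<le> max 1 \<beta> * (x - y)" "\<beta> * y \<le> max 1 \<beta> * y"
    using xy by (intro mult_right_mono; simp)+
  then have lo: "min 1 \<beta> * x \<le> x - (1 - \<beta>) * y" and hi: "x - (1 - \<beta>) * y \<le> max 1 \<beta> * x"
    by (auto simp: algebra_simps)
  have "min 1 (sqrt \<beta>) * norm D = sqrt (min 1 \<beta> * x)" "max 1 (sqrt \<beta>) * norm D = sqrt (max 1 \<beta> * x)"
    by (auto simp: x_def real_sqrt_mult min_def max_def)
  then show "min 1 (sqrt \<beta>) * norm D \<le> beta_norm \<beta> U D"
    "beta_norm \<beta> U D \<le> max 1 (sqrt \<beta>) * norm D"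
    using lo hi by (auto simp: beta_norm_def eq)
qed

section \<open>Lengths of curves and the lower bound\<close>

lemma continuous_on_matrix_matrix_mult [continuous_intros]:
  fixes A :: "'a::topological_space \<Rightarrow> real ^ 'm ^ 'n" and B :: "'a \<Rightarrow> real ^ 'p ^ 'm"
  assumes "continuous_on S A" "continuous_on S B"
  shows "continuous_on S (\<lambda>t. A t ** B t)"
  unfolding matrix_matrix_mult_def using assms by (intro continuous_intros)

lemma continuous_on_transpose [continuous_intros]:
  fixes A :: "'a::topological_space \<Rightarrow> real ^ 'm ^ 'n"
  assumes "continuous_on S A"
  shows "continuous_on S (\<lambda>t. transpose (A t))"
  unfolding transpose_def using assms by (intro continuous_intros)

lemma stiefel_curve_integrable:
  assumes "stiefel_curve \<gamma>"
  shows "(\<lambda>t. beta_norm \<beta> (\<gamma> t) (velocity \<gamma> t)) integrable_on {0..1}"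
    and "(\<lambda>t. norm (velocity \<gamma> t)) integrable_on {0..1}"
proof -
  have "continuous_on {0..1} (velocity \<gamma>)" using assms by (simp add: stiefel_curve_def)
  moreover have "continuous_on {0..1} \<gamma>"
    using assms
    by (auto simp: stiefel_curve_def continuous_on_eq_continuous_within
        intro: differentiable_imp_continuous_within)
  ultimately show "(\<lambda>t. beta_norm \<beta> (\<gamma> t) (velocity \<gamma> t)) integrable_on {0..1}"
    "(\<lambda>t. norm (velocity \<gamma> t)) integrable_on {0..1}"
    unfolding beta_norm_def beta_inner_eq
    by (auto intro!: integrable_continuous_real continuous_intros)
qed

text \<open>The chord is the integral of the velocity, so its norm is at most the integral of the
  Frobenius speed; the speeds are then compared pointwise.\<close>

lemma chord_le_beta_length:
  assumes \<gamma>: "stiefel_curve \<gamma>" and "\<beta> > 0"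
  shows "min 1 (sqrt \<beta>) * norm (\<gamma> 1 - \<gamma> 0) \<le> beta_length \<beta> \<gamma>"
proof -
  have "(\<gamma> has_vector_derivative velocity \<gamma> t) (at t within {0..1})" if "t \<in> {0..1}" for t
    using \<gamma> that by (simp add: stiefel_curve_def velocity_def vector_derivative_works)
  then have i: "(velocity \<gamma> has_integral (\<gamma> 1 - \<gamma> 0)) {0..1}"
    by (intro fundamental_theorem_of_calculus) auto
  then have "norm (\<gamma> 1 - \<gamma> 0) \<le> integral {0..1} (\<lambda>t. norm (velocity \<gamma> t))"
    using integral_norm_bound_integral[OF has_integral_integrable[OF i] stiefel_curve_integrable(2)[OF \<gamma>]]
    by (simp add: integral_unique[OF i])
  then have "min 1 (sqrt \<beta>) * norm (\<gamma> 1 - \<gamma> 0) \<le> min 1 (sqrt \<beta>) * integral {0..1} (\<lambda>t. norm (velocity \<gamma> t))"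
    using \<open>\<beta> > 0\<close> by (intro mult_left_mono) auto
  also have "\<dots> = integral {0..1} (\<lambda>t. min 1 (sqrt \<beta>) * norm (velocity \<gamma> t))"
    by simp
  also have "\<dots> \<le> beta_length \<beta> \<gamma>"
    unfolding beta_length_def using \<gamma> \<open>\<beta> > 0\<close>
    by (intro integral_le stiefel_curve_integrable integrable_on_mult_right beta_norm_bounds)
       (auto simp: stiefel_curve_def)
  finally show ?thesis .
qed

section \<open>A short curve built column by column\<close>

text \<open>The matrix type is indexed by rows first, whereas the isometries act on columns; this
  reassembles a matrix from its moved columns.\<close>

definition columns_matrix :: "('p \<Rightarrow> real ^ 'n) \<Rightarrow> real ^ 'p ^ 'n" where
  "columns_matrix c = (\<chi> i j. c j $ i)"

lemma column_columns_matrix [simp]: "column j (columns_matrix c) = c j"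
  by (simp add: columns_matrix_def column_def vec_eq_iff)

lemma columns_matrix_column [simp]: "columns_matrix (\<lambda>j. column j A) = A"
  by (simp add: columns_matrix_def column_def vec_eq_iff)

text \<open>The matrix is a finite sum of bounded linear images of its columns, where
  \<open>L j\<close> puts a vector into column \<open>j\<close> and zeros elsewhere.\<close>

lemma has_vector_derivative_columns_matrix:
  fixes c :: "real \<Rightarrow> 'p::finite \<Rightarrow> real ^ 'n"
  assumes "\<And>j. ((\<lambda>t. c t j) has_vector_derivative c' j) F"
  shows "((\<lambda>t. columns_matrix (c t)) has_vector_derivative columns_matrix c') F"
proof -
  define L where "L j x = (columns_matrix (\<lambda>k. if k = j then x else 0) :: real ^ 'p ^ 'n)"
    for j :: 'p and x :: "real ^ 'n"
  have "linear (L j)" for j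
    by (auto intro!: linearI simp: L_def columns_matrix_def vec_eq_iff)
  then have L: "bounded_linear (L j)" for j by (simp add: linear_conv_bounded_linear)
  have sumL: "columns_matrix b = (\<Sum>j\<in>UNIV. L j (b j))" for b
    by (simp add: L_def columns_matrix_def vec_eq_iff if_distrib[of "\<lambda>x. x $ _"] cong: if_cong)
  show ?thesis
    unfolding sumL
    by (intro has_vector_derivative_sum bounded_linear.has_vector_derivative[OF L] assms)
qed

lemma stiefel_iff_columns:
  "U \<in> stiefel \<longleftrightarrow> (\<forall>i j. column i U \<bullet> column j U = (if i = j then 1 else 0))"
  by (simp add: stiefel_def vec_eq_iff matrix_matrix_mult_def transpose_def mat_def
      column_def inner_vec_def)

text \<open>The path of isometries from the identity to a rotation taking \<open>V\<close> to
  \<open>U\<close> is applied to each column of \<open>V\<close>. Inner products of columns are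
  preserved, so the curve stays in \<open>stiefel\<close>. The squared Frobenius norm is the sum
  over the columns, so the columnwise speed bounds add up.\<close>

lemma short_stiefel_curve:
  fixes U V :: "real ^ 'p ^ 'n"
  assumes U: "U \<in> stiefel" and V: "V \<in> stiefel" and less: "CARD('p) < CARD('n)"
  obtains \<gamma> where "stiefel_curve \<gamma>" "\<gamma> 0 = V" "\<gamma> 1 = U"
    "\<And>t. t \<in> {0..1} \<Longrightarrow> norm (velocity \<gamma> t) \<le> pi / 2 * norm (V - U)"
proof -
  obtain f where f: "orthogonal_transformation f" "det (matrix f) = 1" "\<And>y. f (V *v y) = U *v y"
    using rotation_extending_stiefel[OF assms] by blast
  obtain F F' where F: "rotation_path UNIV f F F'"
    using rotation_path_UNIV[OF f(1,2)] by blast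
  have F_inner: "F t x \<bullet> F t y = x \<bullet> y" and F01: "F 0 x = x" "F 1 x = f x"
    and F'_cont: "continuous_on UNIV (\<lambda>t. F' t x)"
    and F_der: "((\<lambda>s. F s x) has_vector_derivative F' t x) (at t)"
    and F'_le: "norm (F' t x) \<le> pi / 2 * norm (f x - x)" for t x y
    using F unfolding rotation_path_def by blast+
  have fV: "f (column j V) = column j U" for j
    using f(3)[of "axis j 1"] by (simp add: matrix_vector_mult_basis)
  define \<gamma> where "\<gamma> t = columns_matrix (\<lambda>j. F t (column j V))" for t
  define \<gamma>' where "\<gamma>' t = columns_matrix (\<lambda>j. F' t (column j V))" for t
  have \<gamma>_der: "(\<gamma> has_vector_derivative \<gamma>' t) (at t within {0..1})" for t
    unfolding \<gamma>_def \<gamma>'_def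
    by (rule has_vector_derivative_columns_matrix, rule has_vector_derivative_at_within, rule F_der)
  have vel: "velocity \<gamma> t = \<gamma>' t" if "t \<in> {0..1}" for t
    unfolding velocity_def
    by (rule vector_derivative_within_closed_interval[OF _ that \<gamma>_der]) simp
  have "continuous_on {0..1} \<gamma>'"
    unfolding \<gamma>'_def columns_matrix_def
    by (intro continuous_intros continuous_on_subset[OF F'_cont subset_UNIV])
  then have "stiefel_curve \<gamma>"
    unfolding stiefel_curve_def
  proof (intro conjI ballI)
    show "\<gamma> ` {0..1} \<subseteq> stiefel"
      using V by (auto simp: stiefel_iff_columns \<gamma>_def F_inner)
    show "\<gamma> differentiable (at t within {0..1})" for t
      using \<gamma>_der by (auto simp: has_vector_derivative_def differentiable_def)
    show "continuous_on {0..1} (velocity \<gamma>)" if "continuous_on {0..1} \<gamma>'"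
      by (rule continuous_on_eq[OF that]) (simp add: vel)
  qed
  moreover have "\<gamma> 0 = V" "\<gamma> 1 = U"
    by (simp_all add: \<gamma>_def F01 fV)
  moreover have "norm (velocity \<gamma> t) \<le> pi / 2 * norm (V - U)" if "t \<in> {0..1}" for t
  proof -
    have "(norm (\<gamma>' t))\<^sup>2 = (\<Sum>j\<in>UNIV. (norm (F' t (column j V)))\<^sup>2)"
      by (simp add: power2_norm_eq_inner inner_eq_columns \<gamma>'_def)
    also have "\<dots> \<le> (\<Sum>j\<in>UNIV. (pi / 2 * norm (column j (V - U)))\<^sup>2)"
    proof (intro sum_mono power_mono)
      fix j
      have "norm (F' t (column j V)) \<le> pi / 2 * norm (f (column j V) - column j V)"
        by (rule F'_le)
      also have "f (column j V) - column j V = - column j (V - U)"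
        unfolding fV by (simp add: column_def vec_eq_iff)
      finally show "norm (F' t (column j V)) \<le> pi / 2 * norm (column j (V - U))" by simp
    qed simp
    also have "\<dots> = (pi / 2 * norm (V - U))\<^sup>2"
      by (simp only: power_mult_distrib power2_norm_eq_inner inner_eq_columns[of "V - U"] sum_distrib_left)
    finally show ?thesis
      unfolding vel[OF that] by (rule power2_le_imp_le) simp
  qed
  ultimately show ?thesis using that by blast
qed

section \<open>Passing from curves to the infimum\<close>

theorem corollary7p2:
  fixes U V :: "real ^ 'p ^ 'n" and \<beta> :: real
  assumes "CARD('n) \<ge> 2 * CARD('p)"
    and "\<beta> > 0"
    and "U \<in> stiefel" and "V \<in> stiefel"
  shows "min 1 (sqrt \<beta>) * norm (V - U) \<le> beta_dist \<beta> V U \<and>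
         beta_dist \<beta> V U \<le> max 1 (sqrt \<beta>) * (pi / 2) * norm (V - U)"
proof -
  \<comment> \<open>An index type is nonempty, so p \<ge> 1, and n \<ge> 2p gives the strict
    inequality p < n needed to correct the determinant.\<close>
  have "CARD('p) > 0" by simp
  then have "CARD('p) < CARD('n)" using assms(1) by linarith
  then obtain \<gamma> where \<gamma>: "stiefel_curve \<gamma>" "\<gamma> 0 = V" "\<gamma> 1 = U"
    and vel: "\<And>t. t \<in> {0..1} \<Longrightarrow> norm (velocity \<gamma> t) \<le> pi / 2 * norm (V - U)"
    using short_stiefel_curve assms(3,4) by metis
  let ?C = "{\<gamma>. stiefel_curve \<gamma> \<and> \<gamma> 0 = V \<and> \<gamma> 1 = U}"
  have lower: "min 1 (sqrt \<beta>) * norm (V - U) \<le> beta_length \<beta> \<delta>" if "\<delta> \<in> ?C" for \<delta>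
    using chord_le_beta_length[of \<delta> \<beta>] that assms(2) by (auto simp: norm_minus_commute)
  have "\<gamma> \<in> ?C" using \<gamma> by blast
  \<comment> \<open>The curve \<gamma> makes the set of lengths nonempty; in the next step
    \<open>lower\<close> also supplies the boundedness below that an upper estimate of the infimum
    requires.\<close>
  have "min 1 (sqrt \<beta>) * norm (V - U) \<le> beta_dist \<beta> V U"
    unfolding beta_dist_def using \<open>\<gamma> \<in> ?C\<close> by (intro cINF_greatest lower) blast+
  moreover have "beta_dist \<beta> V U \<le> beta_length \<beta> \<gamma>"
    unfolding beta_dist_def using \<open>\<gamma> \<in> ?C\<close> lower by (intro cINF_lower bdd_belowI2) auto
  moreover have "beta_length \<beta> \<gamma> \<le> integral {0..1} (\<lambda>t::real. max 1 (sqrt \<beta>) * (pi / 2) * norm (V - U))"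
    unfolding beta_length_def
  proof (intro integral_le stiefel_curve_integrable \<gamma>)
    fix t :: real assume t: "t \<in> {0..1}"
    have "beta_norm \<beta> (\<gamma> t) (velocity \<gamma> t) \<le> max 1 (sqrt \<beta>) * norm (velocity \<gamma> t)"
      using \<gamma>(1) t assms(2) by (intro beta_norm_bounds) (auto simp: stiefel_curve_def)
    also have "\<dots> \<le> max 1 (sqrt \<beta>) * (pi / 2 * norm (V - U))"
      using vel[OF t] by (intro mult_left_mono) auto
    finally show "beta_norm \<beta> (\<gamma> t) (velocity \<gamma> t) \<le> max 1 (sqrt \<beta>) * (pi / 2) * norm (V - U)"
      by (simp add: mult.assoc)
  qed auto
  ultimately show ?thesis by simp
qed

end
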